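(* Let $\varepsilon\in(0,1)$. There exists $P_0=P_0(\varepsilon)$ such that for every real $p_0\geq P_0$ the following holds. Let $Q\in[1,\infty)$ and $\delta\in(0,1]$. Suppose $A,B$ are finite sets of square-free positive integers such that for at least $\delta|A||B|$ pairs $(a,b)\in A\times B$ we have $ab/\gcd(a,b)^2\leq Q$. Then \[ |A||B| \leq 1000^{\,1+\#\mathscr{P}_{\mathrm{sml}}(A\cup B)}\,\delta^{-2-\varepsilon}\,\frac{Q}{4}, \] where $\mathscr{P}_{\mathrm{sml}}(A\cup B)$ is the set of primes $p\leq p_0$ dividing some element of $A\cup B$.
   Context: For a finite set $S\subset\mathbf{N}$, $\mathscr{P}_{\mathrm{sml}}(S)$ denotes the set of primes $p\leq p_0$ dividing at least one element of $S$; here $p_0$ is a threshold taken sufficiently large in terms of $\varepsilon$. *)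

theory Defs
  imports Complex_Main
    "HOL-Computational_Algebra.Primes"
    "HOL-Computational_Algebra.Squarefree"
begin

definition primes_sml :: "real \<Rightarrow> nat set \<Rightarrow> nat set" where
  "primes_sml p0 S = {p. prime p \<and> real p \<le> p0 \<and> (\<exists>s\<in>S. p dvd s)}"

end

theory Submission
  imports Defs "HOL-Analysis.Summation_Tests"
begin

text \<open>
  Encode a square-free number by its set of prime factors; then \<open>ab / gcd(a, b)\<^sup>2\<close> is the product over
  the symmetric difference. Put \<open>K = 2 + \<epsilon>\<close>, let \<open>E\<close> be the set of pairs with
  \<open>ab / gcd(a, b)\<^sup>2 \<le> Q\<close>, and give subfamilies \<open>A'\<close>, \<open>B'\<close> spanning \<open>e'\<close> edges the quality
  \<open>e'\<^sup>K (|A'||B'|)\<^sup>1\<^sup>-\<^sup>K\<close>, multiplied by \<open>p\<close> for each prime \<open>p\<close> that separates \<open>A'\<close> from \<open>B'\<close> and by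
  1000 for each small prime whose membership is constant on \<open>A'\<close> and on \<open>B'\<close>. At a pair of maximal
  quality all small primes are constant. For any other prime \<open>p\<close> that does not separate, comparing with
  the four pairs of slices and a two-point inequality shows that, among the edges, either the
  proportion with \<open>p\<close> in both ends or the proportion with \<open>p\<close> in neither end is
  \<open>O(p\<^sup>-\<^sup>2\<^sup>\<theta>)\<close> with \<open>\<theta> = 1 - 1/K > 1/2\<close>, which is summable over \<open>p > p\<^sub>0\<close>. After exchanging the
  roles of ``in'' and ``out'' at suitable primes, half of the edges join coprime \<open>a\<close> and \<open>b\<close>, so
  \<open>ab \<le> Q\<close> up to the separating primes, and counting such pairs through the largest \<open>a\<close> of large degree gives \<open>\<delta>\<^sup>2 |A||B| \<le> 16 Q\<close>.
\<close>

subsection \<open>A two-point inequality\<close>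

text \<open>The base is \<open>4 / D\<close>, where \<open>D = 1 - 2 powr (1 - 2 * \<theta>)\<close>
  is positive for \<theta> > 1/2. The exponent turns a bound on \<open>s powr (1 - \<theta>)\<close>
  into one on \<open>s powr (2 * \<theta>)\<close>.\<close>

definition two_point_const :: "real \<Rightarrow> real" where
  "two_point_const \<theta> = (4 / (1 - 2 powr (1 - 2 * \<theta>))) powr (2 * \<theta> / (1 - \<theta>))"

text \<open>As 2\<theta> > 1 and s \<le> 1/2, convexity gives
  \<open>s powr (2 * \<theta>) \<le> s * (1 - D)\<close> and
  \<open>(1 - s) powr (2 * \<theta>) \<le> 1 - s\<close>. These two terms miss 1 by at least
  \<open>s * D\<close>, which the cross term must supply; cancelling \<open>s powr \<theta>\<close>
  then bounds s.\<close>

lemma two_point_aux: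
  fixes \<theta> s q :: real
  assumes \<theta>: "1 / 2 < \<theta>" "\<theta> < 1" and s: "0 \<le> s" "s \<le> 1 / 2" and q: "0 < q"
    and le: "1 \<le> s powr (2 * \<theta>) + (1 - s) powr (2 * \<theta>) + 4 * q powr (\<theta> - 1) * s powr \<theta>"
  shows "s powr (2 * \<theta>) \<le> two_point_const \<theta> * q powr (- 2 * \<theta>)"
proof (cases "s = 0")
  case True
  then show ?thesis by (simp add: two_point_const_def)
next
  case False
  then have s0: "0 < s" using s by simp
  define D where "D = 1 - 2 powr (1 - 2 * \<theta>)"
  have "2 powr (1 - 2 * \<theta>) < 2 powr (0::real)"
    using \<theta> by (intro powr_less_mono) auto
  then have D: "0 < D" by (simp add: D_def)
  have "s powr (2 * \<theta>) = s * s powr (2 * \<theta> - 1)"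
    using s0 by (simp add: powr_diff)
  also have "\<dots> \<le> s * (1 / 2) powr (2 * \<theta> - 1)"
    using s0 s \<theta> by (intro mult_left_mono powr_mono2) auto
  also have "(1 / 2 :: real) powr (2 * \<theta> - 1) = 1 - D"
    by (simp add: D_def powr_divide powr_minus_divide [symmetric])
  finally have 1: "s powr (2 * \<theta>) \<le> s * (1 - D)" .
  have "(1 - s) powr (2 * \<theta>) \<le> (1 - s) powr 1"
    using s \<theta> by (intro powr_mono') auto
  with 1 le s have "s * D \<le> 4 * q powr (\<theta> - 1) * s powr \<theta>"
    by (simp add: algebra_simps)
  moreover have "s = s powr (1 - \<theta>) * s powr \<theta>"
    using s0 by (simp flip: powr_add)
  ultimately have "(s powr (1 - \<theta>) * D) * s powr \<theta> \<le> (4 * q powr (\<theta> - 1)) * s powr \<theta>"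
    by (simp add: mult_ac)
  then have "s powr (1 - \<theta>) * D \<le> 4 * q powr (\<theta> - 1)"
    using s0 by (subst (asm) mult_le_cancel_right_pos) auto
  then have "s powr (1 - \<theta>) \<le> 4 / D * q powr (\<theta> - 1)"
    using D by (simp add: field_simps)
  then have "(s powr (1 - \<theta>)) powr (2 * \<theta> / (1 - \<theta>))
      \<le> (4 / D * q powr (\<theta> - 1)) powr (2 * \<theta> / (1 - \<theta>))"
    using \<theta> by (intro powr_mono2) auto
  also have "\<dots> = (4 / D) powr (2 * \<theta> / (1 - \<theta>)) * (q powr (\<theta> - 1)) powr (2 * \<theta> / (1 - \<theta>))"
    using D by (intro powr_mult)
  also have "\<dots> = two_point_const \<theta> * q powr ((\<theta> - 1) * (2 * \<theta> / (1 - \<theta>)))"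
    by (simp only: powr_powr two_point_const_def D_def)
  also have "(\<theta> - 1) * (2 * \<theta> / (1 - \<theta>)) = - 2 * \<theta>"
    using \<theta> by (simp add: field_simps)
  finally show ?thesis using \<theta> by (simp add: powr_powr)
qed

text \<open>By the AM-GM inequality both diagonal products only grow when \<alpha> and \<beta> are
  replaced by their mean s. Each off-diagonal product is at most \<open>2 * s\<close>, so the two
  together cost at most \<open>4 * s powr \<theta>\<close>.\<close>

lemma two_point_half:
  fixes \<theta> q \<alpha> \<beta> :: real
  assumes \<theta>: "1 / 2 < \<theta>" "\<theta> < 1" and q: "0 < q"
    and \<alpha>: "0 \<le> \<alpha>" "\<alpha> \<le> 1" and \<beta>: "0 \<le> \<beta>" "\<beta> \<le> 1" and sum: "\<alpha> + \<beta> \<le> 1"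
    and le: "1 \<le> (\<alpha> * \<beta>) powr \<theta> + ((1 - \<alpha>) * (1 - \<beta>)) powr \<theta>
      + q powr (\<theta> - 1) * ((\<alpha> * (1 - \<beta>)) powr \<theta> + ((1 - \<alpha>) * \<beta>) powr \<theta>)"
  shows "(\<alpha> * \<beta>) powr \<theta> \<le> two_point_const \<theta> * q powr (- 2 * \<theta>)"
proof -
  define s where "s = (\<alpha> + \<beta>) / 2"
  have s: "0 \<le> s" "s \<le> 1 / 2" using \<alpha> \<beta> sum by (auto simp: s_def)
  have amgm: "x * y \<le> ((x + y) / 2)\<^sup>2" for x y :: real
    using zero_le_power2 [of "x - y"] by (simp add: power2_eq_square field_simps)
  have sq: "(t\<^sup>2) powr \<theta> = t powr (2 * \<theta>)" if "0 \<le> t" for t :: real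
    using that by (cases "t = 0") (simp_all add: powr_powr flip: powr_numeral)
  have 1: "(\<alpha> * \<beta>) powr \<theta> \<le> s powr (2 * \<theta>)"
    unfolding sq [OF s(1), symmetric] using amgm [of \<alpha> \<beta>] \<alpha> \<beta> \<theta>
    by (intro powr_mono2) (auto simp: s_def)
  have "((1 - \<alpha>) * (1 - \<beta>)) powr \<theta> \<le> ((1 - s)\<^sup>2) powr \<theta>"
  proof (intro powr_mono2)
    have "(1 - \<alpha> + (1 - \<beta>)) / 2 = 1 - s" by (simp add: s_def field_simps)
    with amgm [of "1 - \<alpha>" "1 - \<beta>"] show "(1 - \<alpha>) * (1 - \<beta>) \<le> (1 - s)\<^sup>2" by metis
  qed (use \<alpha> \<beta> \<theta> in auto)
  then have 2: "((1 - \<alpha>) * (1 - \<beta>)) powr \<theta> \<le> (1 - s) powr (2 * \<theta>)"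
    using s by (simp add: sq)
  have cross: "t powr \<theta> \<le> 2 * s powr \<theta>" if t: "0 \<le> t" "t \<le> 2 * s" for t
  proof -
    have "t powr \<theta> \<le> (2 * s) powr \<theta>" using t \<theta> by (intro powr_mono2) auto
    also have "\<dots> = 2 powr \<theta> * s powr \<theta>" using s by (simp add: powr_mult)
    also have "\<dots> \<le> 2 powr 1 * s powr \<theta>"
      using \<theta> by (intro mult_right_mono powr_mono) auto
    finally show ?thesis by simp
  qed
  have "\<alpha> * (1 - \<beta>) \<le> \<alpha> * 1" "(1 - \<alpha>) * \<beta> \<le> 1 * \<beta>"
    using \<alpha> \<beta> by (intro mult_left_mono mult_right_mono; simp)+
  then have "(\<alpha> * (1 - \<beta>)) powr \<theta> \<le> 2 * s powr \<theta>" "((1 - \<alpha>) * \<beta>) powr \<theta> \<le> 2 * s powr \<theta>"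
    using \<alpha> \<beta> by (intro cross; simp add: s_def)+
  then have "q powr (\<theta> - 1) * ((\<alpha> * (1 - \<beta>)) powr \<theta> + ((1 - \<alpha>) * \<beta>) powr \<theta>)
      \<le> q powr (\<theta> - 1) * (4 * s powr \<theta>)"
    by (intro mult_left_mono) auto
  with 1 2 le have "1 \<le> s powr (2 * \<theta>) + (1 - s) powr (2 * \<theta>) + 4 * q powr (\<theta> - 1) * s powr \<theta>"
    by simp
  from 1 two_point_aux [OF \<theta> s q this] show ?thesis by linarith
qed

text \<open>The hypothesis is invariant under replacing \<alpha>, \<beta> by 1 - \<alpha>, 1 -
  \<beta>, which reduces to \<alpha> + \<beta> \<le> 1. Which diagonal term is small depends on the
  case, hence the minimum.\<close>

lemma two_point:
  fixes \<theta> q \<alpha> \<beta> :: real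
  assumes \<theta>: "1 / 2 < \<theta>" "\<theta> < 1" and q: "0 < q"
    and \<alpha>: "0 \<le> \<alpha>" "\<alpha> \<le> 1" and \<beta>: "0 \<le> \<beta>" "\<beta> \<le> 1"
    and le: "1 \<le> (\<alpha> * \<beta>) powr \<theta> + ((1 - \<alpha>) * (1 - \<beta>)) powr \<theta>
      + q powr (\<theta> - 1) * ((\<alpha> * (1 - \<beta>)) powr \<theta> + ((1 - \<alpha>) * \<beta>) powr \<theta>)"
  shows "min ((\<alpha> * \<beta>) powr \<theta>) (((1 - \<alpha>) * (1 - \<beta>)) powr \<theta>)
    \<le> two_point_const \<theta> * q powr (- 2 * \<theta>)"
proof (cases "\<alpha> + \<beta> \<le> 1")
  case True
  from two_point_half [OF \<theta> q \<alpha> \<beta> True le] show ?thesis by (rule min.coboundedI1)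
next
  case False
  have "((1 - \<alpha>) * (1 - \<beta>)) powr \<theta> \<le> two_point_const \<theta> * q powr (- 2 * \<theta>)"
    using \<alpha> \<beta> le False by (intro two_point_half [OF \<theta> q]) (auto simp: algebra_simps)
  then show ?thesis by (rule min.coboundedI2)
qed

subsection \<open>Bipartite graphs whose edges have small products\<close>

text \<open>Discard the vertices of \<open>A\<close> of degree below half the average and look at the survivor \<open>m\<close>
  with the largest label: that label is at least the number of survivors, and the labels of its
  neighbours are at most \<open>R / f m\<close>.\<close>

lemma card_edges_le:
  fixes f :: "'a \<Rightarrow> nat" and g :: "'b \<Rightarrow> nat" and R :: real
  assumes fin: "finite A" "finite B" and F: "F \<subseteq> A \<times> B" "F \<noteq> {}"
    and inj: "inj_on f A" "inj_on g B"
    and pos: "\<And>a. a \<in> A \<Longrightarrow> 0 < f a" "\<And>b. b \<in> B \<Longrightarrow> 0 < g b"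
    and le: "\<And>a b. (a, b) \<in> F \<Longrightarrow> real (f a) * real (g b) \<le> R"
  shows "(real (card F))\<^sup>2 \<le> 4 * R * (real (card A) * real (card B))"
proof -
  define d where "d = real (card F) / (2 * real (card A))"
  define A' where "A' = {a \<in> A. d \<le> real (card (F `` {a}))}"
  have finF: "finite F" using F(1) fin by (meson finite_SigmaI finite_subset)
  have cF: "0 < card F" using finF F(2) by (simp add: card_gt_0_iff)
  have A0: "A \<noteq> {}" "B \<noteq> {}" using F by auto
  have cA: "0 < card A" "0 < card B" using A0 fin by (simp_all add: card_gt_0_iff)
  have d0: "0 < d" using cF cA by (simp add: d_def)
  have sub: "F `` {a} \<subseteq> B" for a using F(1) by auto
  have F_eq: "F = Sigma A (\<lambda>a. F `` {a})" using F(1) by auto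
  have finA': "finite A'" and A'A: "A' \<subseteq> A" using fin by (auto simp: A'_def)
  have "real (card F) = (\<Sum>a\<in>A. real (card (F `` {a})))"
    by (subst F_eq, subst card_SigmaI) (use fin finite_subset [OF sub] in auto)
  also have "\<dots> = (\<Sum>a\<in>A'. real (card (F `` {a}))) + (\<Sum>a\<in>A - A'. real (card (F `` {a})))"
    using fin A'A by (simp add: sum.subset_diff)
  also have "\<dots> \<le> (\<Sum>a\<in>A'. real (card B)) + (\<Sum>a\<in>A. d)"
  proof (intro add_mono)
    show "(\<Sum>a\<in>A'. real (card (F `` {a}))) \<le> (\<Sum>a\<in>A'. real (card B))"
      using sub fin by (intro sum_mono) (simp add: card_mono)
    have "(\<Sum>a\<in>A - A'. real (card (F `` {a}))) \<le> (\<Sum>a\<in>A - A'. d)"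
      by (intro sum_mono) (auto simp: A'_def)
    also have "\<dots> \<le> (\<Sum>a\<in>A. d)" using d0 fin by (intro sum_mono2) auto
    finally show "(\<Sum>a\<in>A - A'. real (card (F `` {a}))) \<le> (\<Sum>a\<in>A. d)" .
  qed
  also have "(\<Sum>a\<in>A. d) = real (card F) / 2" using cA by (simp add: d_def)
  finally have A'_ge: "real (card F) / 2 \<le> real (card A') * real (card B)" by simp
  with cF have "A' \<noteq> {}" by auto
  then have "Max (f ` A') \<in> f ` A'" using finA' by (intro Max_in) auto
  then obtain m where m: "m \<in> A'" "f m = Max (f ` A')" by auto
  have "f ` A' \<subseteq> {1..f m}" using m finA' pos(1) A'A by (auto simp: Suc_le_eq)
  then have "card (f ` A') \<le> card {1..f m}" by (intro card_mono) auto
  then have cA': "card A' \<le> f m"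
    using card_image [OF inj_on_subset [OF inj(1) A'A]] by simp
  have fm: "0 < real (f m)" using m(1) pos(1) A'A by auto
  have R: "0 \<le> R / real (f m)"
  proof -
    obtain a b where "(a, b) \<in> F" using F(2) by auto
    then have "0 \<le> real (f a) * real (g b)" "real (f a) * real (g b) \<le> R" using le by auto
    then have "0 \<le> R" by linarith
    then show ?thesis by simp
  qed
  have "g ` (F `` {m}) \<subseteq> {1..nat \<lfloor>R / real (f m)\<rfloor>}"
  proof
    fix n assume "n \<in> g ` (F `` {m})"
    then obtain b where b: "(m, b) \<in> F" "n = g b" by auto
    from le [OF b(1)] have "real (g b) \<le> R / real (f m)" using fm by (simp add: field_simps)
    moreover have "0 < g b" using b(1) F(1) pos(2) by auto
    ultimately show "n \<in> {1..nat \<lfloor>R / real (f m)\<rfloor>}"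
      using b(2) by (auto simp: Suc_le_eq le_nat_floor)
  qed
  then have "card (g ` (F `` {m})) \<le> card {1..nat \<lfloor>R / real (f m)\<rfloor>}" by (intro card_mono) auto
  then have "card (F `` {m}) \<le> nat \<lfloor>R / real (f m)\<rfloor>"
    using card_image [OF inj_on_subset [OF inj(2) sub]] by simp
  then have "real (card (F `` {m})) \<le> R / real (f m)"
    using R by (meson of_nat_floor of_nat_mono order_trans)
  moreover have "d \<le> real (card (F `` {m}))" using m by (simp add: A'_def)
  ultimately have "d \<le> R / real (f m)" by simp
  then have "d * real (f m) \<le> R" using fm by (simp add: field_simps)
  moreover have "d * real (card A') \<le> d * real (f m)"
    using cA' d0 by (intro mult_left_mono) auto
  ultimately have 1: "d * real (card A') \<le> R" by simp
  \<comment> \<open>One factor \<open>card F\<close> is written as \<open>2 * d * card A\<close>;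
    the other is at most twice the number of survivors times \<open>card B\<close>.\<close>
  have "(real (card F))\<^sup>2 = (4 * d * real (card A)) * (real (card F) / 2)"
    using cA by (simp add: d_def power2_eq_square)
  also have "\<dots> \<le> (4 * d * real (card A)) * (real (card A') * real (card B))"
    using A'_ge d0 by (intro mult_left_mono) auto
  also have "\<dots> = 4 * (d * real (card A')) * (real (card A) * real (card B))" by simp
  also have "\<dots> \<le> 4 * R * (real (card A) * real (card B))"
    using 1 by (intro mult_right_mono) auto
  finally show ?thesis .
qed

subsection \<open>Quality of a pair of families of prime sets\<close>

lemma dvd_prod_primes_iff:
  fixes X :: "nat set"
  assumes "finite X" "\<And>x. x \<in> X \<Longrightarrow> prime x" "prime p"
  shows "p dvd \<Prod>X \<longleftrightarrow> p \<in> X"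
proof
  assume "p dvd \<Prod>X"
  then obtain x where "x \<in> X" "p dvd x"
    using assms prime_dvd_prod_iff [of X p "\<lambda>x. x"] by auto
  then show "p \<in> X" using assms primes_dvd_imp_eq by blast
qed (use assms in \<open>auto intro: dvd_prodI [where f = "\<lambda>x. x", simplified]\<close>)

lemma prod_primes_inj:
  fixes X Y :: "nat set"
  assumes "finite X" "finite Y" "\<And>x. x \<in> X \<union> Y \<Longrightarrow> prime x" "\<Prod>X = \<Prod>Y"
  shows "X = Y"
proof -
  have "p \<in> X \<longleftrightarrow> p \<in> Y" if "prime p" for p
    using assms that dvd_prod_primes_iff [of X p] dvd_prod_primes_iff [of Y p] by auto
  then show ?thesis using assms(3) by blast
qed

definition slice :: "nat set set \<Rightarrow> nat \<Rightarrow> bool \<Rightarrow> nat set set" where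
  "slice A p i = {a \<in> A. (p \<in> a) = i}"

lemma slice_subset: "slice A p i \<subseteq> A"
  by (auto simp: slice_def)

lemma card_slice:
  "finite A \<Longrightarrow> card A = card (slice A p True) + card (slice A p False)"
  by (subst card_Un_disjoint [symmetric]) (auto simp: slice_def intro: arg_cong [where f = card])

lemma card_edges_slices:
  assumes "finite A" "finite B"
  shows "card (E \<inter> A \<times> B) =
    card (E \<inter> slice A p True \<times> slice B p True) + card (E \<inter> slice A p False \<times> slice B p False)
    + (card (E \<inter> slice A p True \<times> slice B p False)
    + card (E \<inter> slice A p False \<times> slice B p True))"
proof -
  have "finite (slice A p i)" "finite (slice B p i)" for i
    using assms by (simp_all add: slice_def)
  then have fin: "finite (E \<inter> slice A p i \<times> slice B p j)" for i j
    by simp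
  have "E \<inter> A \<times> B =
      ((E \<inter> slice A p True \<times> slice B p True) \<union> (E \<inter> slice A p False \<times> slice B p False))
      \<union> ((E \<inter> slice A p True \<times> slice B p False) \<union> (E \<inter> slice A p False \<times> slice B p True))"
    by (auto simp: slice_def)
  also have "card \<dots> = card ((E \<inter> slice A p True \<times> slice B p True) \<union> (E \<inter> slice A p False \<times> slice B p False))
      + card ((E \<inter> slice A p True \<times> slice B p False) \<union> (E \<inter> slice A p False \<times> slice B p True))"
    by (intro card_Un_disjoint finite_UnI fin) (auto simp: slice_def)
  also have "card ((E \<inter> slice A p True \<times> slice B p True) \<union> (E \<inter> slice A p False \<times> slice B p False))
      = card (E \<inter> slice A p True \<times> slice B p True) + card (E \<inter> slice A p False \<times> slice B p False)"
    by (intro card_Un_disjoint fin) (auto simp: slice_def)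
  also have "card ((E \<inter> slice A p True \<times> slice B p False) \<union> (E \<inter> slice A p False \<times> slice B p True))
      = card (E \<inter> slice A p True \<times> slice B p False) + card (E \<inter> slice A p False \<times> slice B p True)"
    by (intro card_Un_disjoint fin) (auto simp: slice_def)
  finally show ?thesis .
qed

text \<open>The primes that separate the two families. If one family is empty and the other is a
  finite family of finite sets, this set is infinite and its product defaults to 1; this is
  harmless, as the quality is 0 without edges.\<close>

definition opposed :: "nat set set \<Rightarrow> nat set set \<Rightarrow> nat set" where
  "opposed A B = {p. (\<forall>a\<in>A. p \<in> a) \<and> (\<forall>b\<in>B. p \<notin> b) \<or> (\<forall>a\<in>A. p \<notin> a) \<and> (\<forall>b\<in>B. p \<in> b)}"

definition settled :: "nat set \<Rightarrow> nat set set \<Rightarrow> nat set set \<Rightarrow> nat set" where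
  "settled L A B = {p \<in> L. ((\<forall>a\<in>A. p \<in> a) \<or> (\<forall>a\<in>A. p \<notin> a)) \<and> ((\<forall>b\<in>B. p \<in> b) \<or> (\<forall>b\<in>B. p \<notin> b))}"

definition weight :: "nat set \<Rightarrow> nat set set \<Rightarrow> nat set set \<Rightarrow> real" where
  "weight L A B = 1000 ^ card (settled L A B) * real (\<Prod>(opposed A B))"

text \<open>Here \<open>L\<close> plays the role of the small primes. Since \<open>4 powr K \<le> 64 < 1000\<close>, settling a small
  prime by passing to the richest of the four pairs of slices increases the quality; the product over
  the opposed primes divides \<open>ab / gcd(a, b)\<^sup>2\<close> for all remaining pairs.\<close>

definition quality ::
    "real \<Rightarrow> nat set \<Rightarrow> (nat set \<times> nat set) set \<Rightarrow> nat set set \<Rightarrow> nat set set \<Rightarrow> real" where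
  "quality K L E A B = real (card (E \<inter> A \<times> B)) powr K
     * (real (card A) * real (card B)) powr (1 - K) * weight L A B"

section \<open>Weights and their growth under passing to subfamilies\<close>

locale prime_set_families =
  fixes L :: "nat set" and A B :: "nat set set"
  assumes finL: "finite L"
    and fin: "finite A" "finite B"
    and finite_elem: "\<And>a. a \<in> A \<union> B \<Longrightarrow> finite a"
    and prime_elem: "\<And>a p. a \<in> A \<union> B \<Longrightarrow> p \<in> a \<Longrightarrow> prime p"
    and nonempty: "A \<noteq> {}" "B \<noteq> {}"
begin

lemma opposed_subset: "opposed A B \<subseteq> \<Union>(A \<union> B)"
  using nonempty by (auto simp: opposed_def)

lemma finite_Union: "finite (\<Union>(A \<union> B))"
  using fin finite_elem by auto

lemma finite_opposed: "finite (opposed A B)"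
  using opposed_subset finite_Union finite_subset by blast

lemma prime_opposed: "p \<in> opposed A B \<Longrightarrow> prime p"
  using opposed_subset prime_elem by blast

lemma prod_opposed_pos: "0 < \<Prod>(opposed A B)"
  by (intro prod_pos prime_gt_0_nat prime_opposed)

lemma finite_settled: "finite (settled L A B)"
  using finL by (auto simp: settled_def)

lemma weight_ge_1: "1 \<le> weight L A B"
proof -
  have "1 \<le> (1000 :: real) ^ card (settled L A B)" by (rule one_le_power) simp
  moreover have "1 \<le> real (\<Prod>(opposed A B))" using prod_opposed_pos by linarith
  ultimately show ?thesis
    using mult_mono [of "1::real" _ 1] by (force simp: weight_def)
qed

end

locale prime_set_subfamilies = prime_set_families L A B + sub: prime_set_families L A' B'
  for L A B A' B' +
  assumes subset: "A' \<subseteq> A" "B' \<subseteq> B"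
begin

lemma opposed_mono: "opposed A B \<subseteq> opposed A' B'"
  using subset unfolding opposed_def by blast

lemma settled_mono: "settled L A B \<subseteq> settled L A' B'"
  using subset unfolding settled_def by blast

lemma power_settled_mono: "(1000::real) ^ card (settled L A B) \<le> 1000 ^ card (settled L A' B')"
  using settled_mono sub.finite_settled by (intro power_increasing card_mono) auto

lemma prod_opposed_mono: "\<Prod>(opposed A B) \<le> \<Prod>(opposed A' B')"
  \<comment> \<open>The product over a larger finite set of primes is a positive multiple of the
    product over the smaller one.\<close>
  using opposed_mono sub.finite_opposed sub.prod_opposed_pos
  by (intro dvd_imp_le prod_dvd_prod_subset) auto

lemma weight_mono: "weight L A B \<le> weight L A' B'"
  unfolding weight_def using power_settled_mono prod_opposed_mono
  by (intro mult_mono) (simp_all del: of_nat_prod)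

lemma weight_newly_settled:
  assumes "p \<notin> settled L A B" "p \<in> settled L A' B'"
  shows "1000 * weight L A B \<le> weight L A' B'"
proof -
  have "Suc (card (settled L A B)) = card (insert p (settled L A B))"
    using assms finite_settled by simp
  also have "\<dots> \<le> card (settled L A' B')"
    using assms settled_mono sub.finite_settled by (intro card_mono) auto
  finally have "(1000::real) ^ Suc (card (settled L A B)) \<le> 1000 ^ card (settled L A' B')"
    by (intro power_increasing) auto
  then have "1000 ^ Suc (card (settled L A B)) * real (\<Prod>(opposed A B)) \<le> weight L A' B'"
    unfolding weight_def using prod_opposed_mono by (intro mult_mono) (simp_all del: of_nat_prod)
  then show ?thesis by (simp add: weight_def mult_ac)
qed

lemma weight_newly_opposed:
  assumes "p \<notin> opposed A B" "p \<in> opposed A' B'"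
  shows "real p * weight L A B \<le> weight L A' B'"
proof -
  have "p * \<Prod>(opposed A B) = \<Prod>(insert p (opposed A B))"
    using assms finite_opposed by simp
  also have "\<dots> \<le> \<Prod>(opposed A' B')"
    using assms opposed_mono sub.finite_opposed sub.prod_opposed_pos
    by (intro dvd_imp_le prod_dvd_prod_subset) auto
  finally have "1000 ^ card (settled L A B) * real (p * \<Prod>(opposed A B)) \<le> weight L A' B'"
    unfolding weight_def using power_settled_mono
    by (intro mult_mono) (simp_all del: of_nat_prod of_nat_mult)
  then show ?thesis by (simp add: weight_def mult_ac)
qed

end

section \<open>Pairs of maximal quality\<close>

locale optimal_pair = prime_set_families L A B for L A B +
  fixes K :: real and E :: "(nat set \<times> nat set) set"
  assumes K: "2 < K" "K \<le> 3"
    and edges_nonempty: "E \<inter> A \<times> B \<noteq> {}"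
    and optimal: "\<And>A' B'. A' \<subseteq> A \<Longrightarrow> B' \<subseteq> B \<Longrightarrow> quality K L E A' B' \<le> quality K L E A B"
begin

abbreviation edges :: "nat set set \<Rightarrow> nat set set \<Rightarrow> real" where
  "edges A' B' \<equiv> real (card (E \<inter> A' \<times> B'))"

abbreviation part :: "nat set set \<Rightarrow> nat \<Rightarrow> bool \<Rightarrow> real" where
  "part X p i \<equiv> real (card (slice X p i)) / real (card X)"

text \<open>The exponent of the density of vertex pairs once the comparison of two qualities is
  raised to the power \<open>1 / K\<close>. It exceeds 1/2 because K > 2, which makes the sum over
  large primes converge.\<close>

definition \<theta> :: real where "\<theta> = 1 - 1 / K"

lemma \<theta>: "1 / 2 < \<theta>" "\<theta> < 1"
  using K by (auto simp: \<theta>_def field_simps)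

lemma finite_edges: "finite (E \<inter> A \<times> B)"
  using fin by auto

lemma edges_pos: "0 < edges A B"
  using edges_nonempty finite_edges by (simp add: card_gt_0_iff)

lemma card_pos: "0 < card A" "0 < card B"
  using fin nonempty by (simp_all add: card_gt_0_iff)

text \<open>The K-th root of the optimality inequality, solved for the edges of the subpair. A gain
  of w in weight becomes a saving of \<open>w powr (\<theta> - 1)\<close>, that is
  \<open>w powr (- 1 / K)\<close>. The gain has to be shown only if the subpair has an edge, since
  otherwise the left side is 0.\<close>

lemma edges_le:
  assumes sub: "A' \<subseteq> A" "B' \<subseteq> B" and w: "0 < w"
    and weight: "E \<inter> A' \<times> B' \<noteq> {} \<Longrightarrow> w * weight L A B \<le> weight L A' B'"
  shows "edges A' B' \<le> edges A B * (w powr (\<theta> - 1)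
    * (real (card A') / real (card A) * (real (card B') / real (card B))) powr \<theta>)"
proof (cases "E \<inter> A' \<times> B' = {}")
  case False
  define m where "m = real (card A) * real (card B)"
  define m' where "m' = real (card A') * real (card B')"
  have fin': "finite A'" "finite B'" using sub fin finite_subset by blast+
  have m: "0 < m" using card_pos by (simp add: m_def)
  have "A' \<noteq> {}" "B' \<noteq> {}" using False by auto
  then have m': "0 < m'" using fin' by (simp add: m'_def card_gt_0_iff)
  have W: "0 < weight L A B" using weight_ge_1 by linarith
  have "edges A' B' powr K * m' powr (1 - K) * (w * weight L A B) \<le> quality K L E A' B'"
    unfolding quality_def m'_def using weight [OF False] by (intro mult_left_mono) auto
  also have "\<dots> \<le> quality K L E A B" using sub by (rule optimal)
  also have "\<dots> = edges A B powr K * m powr (1 - K) * weight L A B"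
    by (simp add: quality_def m_def)
  finally have "edges A' B' powr K * m' powr (1 - K) * w \<le> edges A B powr K * m powr (1 - K)"
    using W by (simp flip: mult.assoc)
  then have "(edges A' B' powr K * m' powr (1 - K) * w) powr (1 / K)
      \<le> (edges A B powr K * m powr (1 - K)) powr (1 / K)"
    using K w by (intro powr_mono2) auto
  moreover have "(1 - K) * (1 / K) = - \<theta>" using K by (simp add: \<theta>_def field_simps)
  moreover have "1 / K = 1 - \<theta>" "K * (1 - \<theta>) = 1" using K by (simp_all add: \<theta>_def)
  ultimately have "edges A' B' * m' powr - \<theta> * w powr (1 - \<theta>) \<le> edges A B * m powr - \<theta>"
    by (simp add: powr_mult powr_powr)
  then have "edges A' B' * m' powr - \<theta> * w powr (1 - \<theta>) * (m' powr \<theta> * w powr (\<theta> - 1))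
      \<le> edges A B * m powr - \<theta> * (m' powr \<theta> * w powr (\<theta> - 1))"
    by (intro mult_right_mono) auto
  also have "\<dots> = edges A B * (m' powr \<theta> * m powr - \<theta>) * w powr (\<theta> - 1)"
    by (simp only: mult_ac)
  also have "edges A' B' * m' powr - \<theta> * w powr (1 - \<theta>) * (m' powr \<theta> * w powr (\<theta> - 1))
      = edges A' B' * (m' powr - \<theta> * m' powr \<theta>) * (w powr (1 - \<theta>) * w powr (\<theta> - 1))"
    by (simp only: mult_ac)
  also have "\<dots> = edges A' B'"
    using m' w by (simp flip: powr_add)
  also have "m' powr \<theta> * m powr - \<theta> = (m' / m) powr \<theta>"
    using m m' by (simp add: powr_minus_divide powr_divide)
  also have "m' / m = real (card A') / real (card A) * (real (card B') / real (card B))"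
    by (simp add: m_def m'_def)
  finally show ?thesis by (simp add: mult_ac)
qed auto

lemma subfamilies:
  assumes "A' \<subseteq> A" "B' \<subseteq> B" "E \<inter> A' \<times> B' \<noteq> {}"
  shows "prime_set_subfamilies L A B A' B'"
proof
  show "finite A'" "finite B'" using assms fin finite_subset by blast+
qed (use assms finL finite_elem prime_elem in blast)+

lemma part_bounds: "0 \<le> part X p i" "X = A \<or> X = B \<Longrightarrow> part X p i \<le> 1"
  using fin card_pos by (auto simp: divide_le_eq slice_def intro!: card_mono)

lemma part_False:
  assumes "X = A \<or> X = B"
  shows "part X p False = 1 - part X p True"
proof -
  have "finite X" "0 < card X" using assms fin card_pos by auto
  then have "real (card (slice X p True)) + real (card (slice X p False)) = real (card X)"
    using card_slice [of X p] by simp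
  then have "part X p True + part X p False = 1"
    using \<open>0 < card X\<close> by (simp flip: add_divide_distrib)
  then show ?thesis by simp
qed

lemma edges_slices_le:
  assumes "0 < w"
    and "E \<inter> slice A p i \<times> slice B p j \<noteq> {} \<Longrightarrow>
      prime_set_subfamilies L A B (slice A p i) (slice B p j) \<Longrightarrow>
      w * weight L A B \<le> weight L (slice A p i) (slice B p j)"
  shows "edges (slice A p i) (slice B p j)
    \<le> edges A B * (w powr (\<theta> - 1) * (part A p i * part B p j) powr \<theta>)"
  using assms subfamilies [OF slice_subset slice_subset, of p i p j]
  by (intro edges_le slice_subset) blast+

text \<open>All four pairs of slices at p settle p. If p were not settled yet, each of them would
  gain a factor 1000 and so carry at most a tenth of the edges, yet together they carry all of
  them.\<close>

lemma small_settled: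
  assumes p: "p \<in> L"
  shows "p \<in> settled L A B"
proof (rule ccontr)
  assume not: "p \<notin> settled L A B"
  have small: "edges (slice A p i) (slice B p j) \<le> edges A B * (1 / 10)" for i j
  proof -
    have "edges (slice A p i) (slice B p j)
        \<le> edges A B * (1000 powr (\<theta> - 1) * (part A p i * part B p j) powr \<theta>)"
    proof (rule edges_slices_le)
      assume "prime_set_subfamilies L A B (slice A p i) (slice B p j)"
      then interpret prime_set_subfamilies L A B "slice A p i" "slice B p j" .
      have "p \<in> settled L (slice A p i) (slice B p j)"
        using p by (auto simp: settled_def slice_def)
      from weight_newly_settled [OF not this]
      show "1000 * weight L A B \<le> weight L (slice A p i) (slice B p j)" .
    qed simp
    also have "\<dots> \<le> edges A B * (1 / 10 * 1)"
    proof (intro mult_left_mono mult_mono)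
      \<comment> \<open>Since K \<le> 3, the saving is at least the cube root of 1000.\<close>
      have "1000 powr (\<theta> - 1) \<le> 1000 powr - (1 / 3 :: real)"
        using K by (intro powr_mono) (auto simp: \<theta>_def field_simps)
      also have "\<dots> = 1 / (10 powr 3) powr (1 / 3 :: real)"
        by (simp add: powr_minus_divide)
      also have "\<dots> = 1 / 10" by (simp only: powr_powr) simp
      finally show "1000 powr (\<theta> - 1) \<le> 1 / 10" .
      have "part A p i * part B p j \<le> 1"
        using part_bounds by (intro mult_le_one) auto
      then have "(part A p i * part B p j) powr \<theta> \<le> 1 powr \<theta>"
        using \<theta> by (intro powr_mono2) auto
      then show "(part A p i * part B p j) powr \<theta> \<le> 1" by simp
    qed auto
    finally show ?thesis by simp
  qed
  have "edges A B \<le> edges A B * (4 / 10)"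
    using small [of True True] small [of True False] small [of False True] small [of False False]
    by (subst (1) card_edges_slices [OF fin, of E p]) simp
  with edges_pos show False by simp
qed

text \<open>The two pairs of slices that agree at p lose no weight, and the two that disagree make p
  opposed and gain a factor p. Summing the four edge bounds and dividing by the number of edges
  gives the hypothesis of \<open>two_point\<close>.\<close>

lemma min_edges_le:
  assumes p: "0 < p" and not: "p \<notin> opposed A B"
  shows "min (edges (slice A p True) (slice B p True)) (edges (slice A p False) (slice B p False))
    \<le> edges A B * (two_point_const \<theta> * real p powr (- 2 * \<theta>))"
proof -
  define \<alpha> \<beta> where "\<alpha> = part A p True" and "\<beta> = part B p True"
  have same: "edges (slice A p i) (slice B p i) \<le> edges A B * (part A p i * part B p i) powr \<theta>" for i
  proof -
    have "edges (slice A p i) (slice B p i)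
        \<le> edges A B * (1 powr (\<theta> - 1) * (part A p i * part B p i) powr \<theta>)"
    proof (rule edges_slices_le)
      assume "prime_set_subfamilies L A B (slice A p i) (slice B p i)"
      then interpret prime_set_subfamilies L A B "slice A p i" "slice B p i" .
      show "1 * weight L A B \<le> weight L (slice A p i) (slice B p i)"
        using weight_mono by simp
    qed simp
    then show ?thesis by simp
  qed
  have differ: "edges (slice A p i) (slice B p (\<not> i))
      \<le> edges A B * (real p powr (\<theta> - 1) * (part A p i * part B p (\<not> i)) powr \<theta>)" for i
  proof (rule edges_slices_le)
    assume "prime_set_subfamilies L A B (slice A p i) (slice B p (\<not> i))"
    then interpret prime_set_subfamilies L A B "slice A p i" "slice B p (\<not> i)" .
    have "p \<in> opposed (slice A p i) (slice B p (\<not> i))"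
      by (cases i) (auto simp: opposed_def slice_def)
    from weight_newly_opposed [OF not this]
    show "real p * weight L A B \<le> weight L (slice A p i) (slice B p (\<not> i))" .
  qed (use p in simp)
  have F: "part A p False = 1 - \<alpha>" "part B p False = 1 - \<beta>"
    using part_False by (auto simp: \<alpha>_def \<beta>_def)
  have b: "edges (slice A p True) (slice B p True) \<le> edges A B * (\<alpha> * \<beta>) powr \<theta>"
    "edges (slice A p False) (slice B p False) \<le> edges A B * ((1 - \<alpha>) * (1 - \<beta>)) powr \<theta>"
    "edges (slice A p True) (slice B p False)
      \<le> edges A B * (real p powr (\<theta> - 1) * (\<alpha> * (1 - \<beta>)) powr \<theta>)"
    "edges (slice A p False) (slice B p True)
      \<le> edges A B * (real p powr (\<theta> - 1) * ((1 - \<alpha>) * \<beta>) powr \<theta>)"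
    using same [of True] same [of False] differ [of True] differ [of False]
    by (simp_all add: F flip: \<alpha>_def \<beta>_def)
  define x where "x = (\<alpha> * \<beta>) powr \<theta> + ((1 - \<alpha>) * (1 - \<beta>)) powr \<theta>
      + real p powr (\<theta> - 1) * ((\<alpha> * (1 - \<beta>)) powr \<theta> + ((1 - \<alpha>) * \<beta>) powr \<theta>)"
  have "edges A B \<le> edges A B * x"
    unfolding x_def using b
    by (subst (1) card_edges_slices [OF fin, of E p]) (simp add: algebra_simps)
  then have "1 \<le> x" using edges_pos by simp
  then have "min ((\<alpha> * \<beta>) powr \<theta>) (((1 - \<alpha>) * (1 - \<beta>)) powr \<theta>)
      \<le> two_point_const \<theta> * real p powr (- 2 * \<theta>)"
    unfolding x_def using part_bounds p
    by (intro two_point [OF \<theta>]) (auto simp: \<alpha>_def \<beta>_def)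
  then have "edges A B * min ((\<alpha> * \<beta>) powr \<theta>) (((1 - \<alpha>) * (1 - \<beta>)) powr \<theta>)
      \<le> edges A B * (two_point_const \<theta> * real p powr (- 2 * \<theta>))"
    by (intro mult_left_mono) auto
  then show ?thesis
    using b(1,2) by (auto simp: min_def split: if_splits)
qed

text \<open>A settled prime leaves one of the two slices of \<open>A\<close> empty, so small primes
  contribute nothing to the minority edges.\<close>

lemma min_edges_small:
  assumes "p \<in> L"
  shows "edges (slice A p True) (slice B p True) = 0
    \<or> edges (slice A p False) (slice B p False) = 0"
proof -
  have "slice A p True = {} \<or> slice A p False = {}"
    using small_settled [OF assms] by (auto simp: settled_def slice_def)
  then show ?thesis by auto
qed


text \<open>Symmetric differences are invariant under flipping the membership of a fixed set of primes in
  all members of both families. We flip so that, for each prime that is not opposed, the edges whose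
  two ends both contain it become the minority; then at least half of the edges join disjoint sets.\<close>

lemma quality_le:
  assumes tail: "(\<Sum>p\<in>\<Union>(A \<union> B) - L. two_point_const \<theta> * real p powr (- 2 * \<theta>)) \<le> 1 / 2"
    and Q: "\<And>a b. (a, b) \<in> E \<Longrightarrow> real (\<Prod>((a - b) \<union> (b - a))) \<le> Q"
  shows "quality K L E A B \<le> 16 * 1000 ^ card L * Q"
proof -
  define U where "U = \<Union>(A \<union> B)"
  define Z where "Z = opposed A B"
  define both where "both p i = E \<inter> slice A p i \<times> slice B p i" for p i
  define S where "S = {p \<in> U. card (both p False) \<le> card (both p True)}"
  \<comment> \<open>Dropping \<open>Z\<close> loses no information, as membership of an opposed
    prime is constant on each family; it separates the factor \<open>\<Prod>Z\<close> from the
    product over the symmetric difference.\<close>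
  define flip where "flip a = ((a - S) \<union> (S - a)) - Z" for a
  define F where "F = {(a, b) \<in> E \<inter> A \<times> B. flip a \<inter> flip b = {}}"
  have U: "finite U" "\<And>p. p \<in> U \<Longrightarrow> prime p"
    using finite_Union prime_elem by (auto simp: U_def)
  have sub_U: "a \<subseteq> U" if "a \<in> A \<union> B" for a using that by (auto simp: U_def)
  have ZU: "Z \<subseteq> U" using opposed_subset by (simp add: Z_def U_def)
  have flip_U: "flip a \<subseteq> U" if "a \<in> A \<union> B" for a
    using sub_U [OF that] by (auto simp: flip_def S_def)
  then have fin_flip: "finite (flip a)" if "a \<in> A \<union> B" for a
    using that U(1) finite_subset by blast
  have prime_flip: "prime p" if "p \<in> flip a" "a \<in> A \<union> B" for a p
    using that flip_U U(2) by blast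
  have mem_flip: "p \<in> flip c \<longleftrightarrow> (p \<in> c) \<noteq> (p \<in> S)" if "p \<notin> Z" for c p
    using that by (auto simp: flip_def)
  have inj: "inj_on (\<lambda>a. \<Prod>(flip a)) X" if X: "X = A \<or> X = B" for X
  proof (rule inj_onI)
    fix a a' assume a: "a \<in> X" "a' \<in> X" and eq: "\<Prod>(flip a) = \<Prod>(flip a')"
    have aU: "a \<in> A \<union> B" "a' \<in> A \<union> B" using X a by auto
    have "flip a = flip a'"
      using aU eq by (intro prod_primes_inj fin_flip) (auto dest: prime_flip)
    show "a = a'"
    proof (rule set_eqI)
      fix p
      show "p \<in> a \<longleftrightarrow> p \<in> a'"
      proof (cases "p \<in> Z")
        case True
        then show ?thesis using X a by (auto simp: Z_def opposed_def)
      next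
        case False
        then have "(p \<in> a) \<noteq> (p \<in> S) \<longleftrightarrow> (p \<in> a') \<noteq> (p \<in> S)"
          using mem_flip [of p a] mem_flip [of p a'] \<open>flip a = flip a'\<close> by simp
        then show ?thesis by argo
      qed
    qed
  qed
  have pos: "0 < \<Prod>(flip a)" if "a \<in> A \<union> B" for a
    using prime_flip that by (intro prod_pos prime_gt_0_nat)
  have Zpos: "0 < \<Prod>Z" using prod_opposed_pos by (simp add: Z_def)

  \<comment> \<open>For disjoint flipped sets, the symmetric difference of a and b is the disjoint
    union of \<open>flip a\<close>, \<open>flip b\<close> and \<open>Z\<close>, so its product
    splits into three factors.\<close>
  have F_le: "real (\<Prod>(flip a)) * real (\<Prod>(flip b)) \<le> Q / real (\<Prod>Z)" if "(a, b) \<in> F" for a b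
  proof -
    have ab: "(a, b) \<in> E" "a \<in> A" "b \<in> B" "flip a \<inter> flip b = {}"
      using that by (auto simp: F_def)
    have eq: "(a - b) \<union> (b - a) = (flip a \<union> flip b) \<union> Z"
    proof (rule set_eqI)
      fix p
      show "p \<in> (a - b) \<union> (b - a) \<longleftrightarrow> p \<in> (flip a \<union> flip b) \<union> Z"
      proof (cases "p \<in> Z")
        case True
        then show ?thesis using ab(2,3) by (auto simp: Z_def opposed_def)
      next
        case False
        have "p \<notin> flip a \<or> p \<notin> flip b" using ab(4) by auto
        then show ?thesis
          using False mem_flip [of p a] mem_flip [of p b] by simp argo
      qed
    qed
    have "\<Prod>((a - b) \<union> (b - a)) = \<Prod>(flip a \<union> flip b) * \<Prod>Z"
      unfolding eq using ab fin_flip finite_subset [OF ZU U(1)]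
      by (intro prod.union_disjoint) (auto simp: flip_def)
    also have "\<Prod>(flip a \<union> flip b) = \<Prod>(flip a) * \<Prod>(flip b)"
      using ab fin_flip by (intro prod.union_disjoint) auto
    finally show ?thesis
      using Q [OF ab(1)] Zpos
      by (subst pos_le_divide_eq) (simp_all add: mult_ac del: of_nat_prod flip: of_nat_mult)
  qed

  \<comment> \<open>The edges both of whose flipped ends contain p. By the choice of
    \<open>S\<close> this is the smaller of the two agreeing classes, so the minimum bounds apply to
    it.\<close>
  define M where "M p = both p (p \<notin> S)" for p
  have finM: "finite (M p)" for p
    by (rule finite_subset [OF _ finite_edges]) (auto simp: M_def both_def slice_def)
  have M_le: "real (card (M p)) \<le>
      (if p \<in> L then 0 else edges A B * (two_point_const \<theta> * real p powr (- 2 * \<theta>)))"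
    if p: "p \<in> U - Z" for p
  proof -
    have "real (card (M p)) = min (edges (slice A p True) (slice B p True))
        (edges (slice A p False) (slice B p False))"
    proof (cases "p \<in> S")
      case True
      then have "card (both p False) \<le> card (both p True)" by (simp add: S_def)
      with True show ?thesis by (simp add: M_def both_def)
    next
      case False
      then have "card (both p True) \<le> card (both p False)" using p by (simp add: S_def)
      with False show ?thesis by (simp add: M_def both_def)
    qed
    moreover have "p \<notin> opposed A B" "0 < p"
      using p U(2) prime_gt_0_nat by (auto simp: Z_def)
    ultimately show ?thesis
      using min_edges_le [of p] min_edges_small [of p] by auto
  qed
  \<comment> \<open>An edge outside \<open>F\<close> has a prime common to its two flipped ends, so
    a union bound over the primes outside \<open>Z\<close> applies.\<close>
  have "E \<inter> A \<times> B \<subseteq> F \<union> (\<Union>p\<in>U - Z. M p)"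
  proof clarify
    fix a b assume ab: "(a, b) \<in> E" "a \<in> A" "b \<in> B" "(a, b) \<notin> (\<Union>p\<in>U - Z. M p)"
    have "flip a \<inter> flip b = {}"
    proof (rule ccontr)
      assume "flip a \<inter> flip b \<noteq> {}"
      then obtain p where p: "p \<in> flip a" "p \<in> flip b" by auto
      then have "p \<in> U - Z" using flip_U ab by (auto simp: flip_def)
      moreover have "(a, b) \<in> M p" using p ab by (auto simp: M_def both_def slice_def flip_def)
      ultimately show False using ab by blast
    qed
    with ab show "(a, b) \<in> F" by (auto simp: F_def)
  qed
  moreover have finF: "finite F" by (rule finite_subset [OF _ finite_edges]) (auto simp: F_def)
  ultimately have "card (E \<inter> A \<times> B) \<le> card (F \<union> (\<Union>p\<in>U - Z. M p))"
    using finM U by (intro card_mono) auto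
  also have "\<dots> \<le> card F + card (\<Union>p\<in>U - Z. M p)" by (rule card_Un_le)
  also have "\<dots> \<le> card F + (\<Sum>p\<in>U - Z. card (M p))"
    using U finM by (intro add_left_mono card_UN_le) auto
  finally have "edges A B \<le> real (card F) + (\<Sum>p\<in>U - Z. real (card (M p)))"
    by (metis of_nat_add of_nat_mono of_nat_sum)
  also have "(\<Sum>p\<in>U - Z. real (card (M p)))
      \<le> (\<Sum>p\<in>U - Z. if p \<in> L then 0 else edges A B * (two_point_const \<theta> * real p powr (- 2 * \<theta>)))"
    using M_le by (intro sum_mono) auto
  also have "\<dots> = (\<Sum>p\<in>U - Z - L. edges A B * (two_point_const \<theta> * real p powr (- 2 * \<theta>)))"
    using U by (intro sum.mono_neutral_cong_right) auto
  also have "\<dots> \<le> (\<Sum>p\<in>U - L. edges A B * (two_point_const \<theta> * real p powr (- 2 * \<theta>)))"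
    using U by (intro sum_mono2) (auto simp: two_point_const_def)
  also have "\<dots> = edges A B * (\<Sum>p\<in>U - L. two_point_const \<theta> * real p powr (- 2 * \<theta>))"
    by (simp add: sum_distrib_left)
  also have "\<dots> \<le> edges A B * (1 / 2)"
    using tail by (intro mult_left_mono) (auto simp: U_def)
  finally have half: "edges A B \<le> 2 * real (card F)" by simp
  with edges_pos have "F \<noteq> {}" by auto

  define z where "z = real (\<Prod>Z)"
  have z: "0 < z" using Zpos unfolding z_def by (simp only: of_nat_0_less_iff)
  define m where "m = real (card A) * real (card B)"
  have m: "0 < m" using card_pos by (simp add: m_def)
  have "(edges A B)\<^sup>2 \<le> (2 * real (card F))\<^sup>2" using half by (intro power_mono) auto
  also have "\<dots> = 4 * (real (card F))\<^sup>2" by (simp add: power2_eq_square)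
  \<comment> \<open>The flipped products serve as distinct positive labels, and the bound on their
    product has already been divided by z.\<close>
  also have "(real (card F))\<^sup>2 \<le> 4 * (Q / z) * m"
    unfolding m_def z_def using F_le \<open>F \<noteq> {}\<close> inj pos fin
    by (intro card_edges_le [where f = "\<lambda>a. \<Prod>(flip a)" and g = "\<lambda>b. \<Prod>(flip b)"])
      (auto simp: F_def)
  finally have "(edges A B)\<^sup>2 * z \<le> 16 * Q * m"
    using z by (simp add: field_simps)
  then have sq: "(edges A B)\<^sup>2 / m * z \<le> 16 * Q"
    using m by (simp add: field_simps)
  have "card (E \<inter> A \<times> B) \<le> card (A \<times> B)" using fin by (intro card_mono) auto
  then have "card (E \<inter> A \<times> B) \<le> card A * card B" by (simp add: card_cartesian_product)
  then have "edges A B \<le> m" unfolding m_def by (metis of_nat_le_iff of_nat_mult)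
  \<comment> \<open>The exponent K may be lowered to 2 because the edge density is at most
    1.\<close>
  have "edges A B powr K * m powr (1 - K) = (edges A B)\<^sup>2 / m * (edges A B / m) powr (K - 2)"
  proof -
    have "edges A B powr K = edges A B powr 2 * edges A B powr (K - 2)"
      by (subst powr_add [symmetric]) simp
    moreover have "m powr (1 - K) = 1 / m powr (1 + (K - 2))"
      by (simp flip: powr_minus_divide)
    moreover have "m powr (1 + (K - 2)) = m * m powr (K - 2)"
      using m by (subst powr_add) simp
    moreover have "(edges A B / m) powr (K - 2) = edges A B powr (K - 2) / m powr (K - 2)"
      by (rule powr_divide)
    ultimately show ?thesis
      using edges_pos by simp
  qed
  also have "\<dots> \<le> (edges A B)\<^sup>2 / m * 1"
  proof (intro mult_left_mono)
    have "(edges A B / m) powr (K - 2) \<le> 1 powr (K - 2)"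
      using K m \<open>edges A B \<le> m\<close> by (intro powr_mono2) auto
    then show "(edges A B / m) powr (K - 2) \<le> 1" by simp
  qed (use m in auto)
  finally have 1: "edges A B powr K * m powr (1 - K) \<le> (edges A B)\<^sup>2 / m" by simp
  have "quality K L E A B = edges A B powr K * m powr (1 - K) * weight L A B"
    by (simp add: quality_def m_def)
  also have "\<dots> \<le> (edges A B)\<^sup>2 / m * weight L A B"
    using 1 weight_ge_1 by (intro mult_right_mono) auto
  \<comment> \<open>The opposed primes enter the weight with exactly the factor z saved in the edge
    count.\<close>
  also have "\<dots> = 1000 ^ card (settled L A B) * ((edges A B)\<^sup>2 / m * z)"
    by (simp add: weight_def Z_def z_def)
  also have "\<dots> \<le> 1000 ^ card L * (16 * Q)"
  proof (rule mult_mono [OF _ sq])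
    show "(1000::real) ^ card (settled L A B) \<le> 1000 ^ card L"
      using finL by (intro power_increasing card_mono) (auto simp: settled_def)
  qed (use m z in auto)
  finally show ?thesis by simp
qed

end

text \<open>Among the finitely many subpairs one has maximal quality, and the bound for it passes
  back: the left side is at most the quality of the full pair because weights are at least 1. The
  assumptions on the tail and on Q are inherited by subfamilies.\<close>

lemma card_edges_powr_le:
  fixes L :: "nat set" and A B :: "nat set set" and K Q :: real
  assumes "prime_set_families L A B" and K: "2 < K" "K \<le> 3" and \<theta>: "\<theta> = 1 - 1 / K"
    and Q0: "0 \<le> Q"
    and tail: "(\<Sum>p\<in>\<Union>(A \<union> B) - L. two_point_const \<theta> * real p powr (- 2 * \<theta>)) \<le> 1 / 2"
    and Q: "\<And>a b. (a, b) \<in> E \<Longrightarrow> real (\<Prod>((a - b) \<union> (b - a))) \<le> Q"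
  shows "real (card (E \<inter> A \<times> B)) powr K * (real (card A) * real (card B)) powr (1 - K)
    \<le> 16 * 1000 ^ card L * Q"
proof (cases "E \<inter> A \<times> B = {}")
  case True
  then show ?thesis using Q0 by simp
next
  case False
  interpret prime_set_families L A B by fact
  let ?P = "Pow A \<times> Pow B"
  let ?q = "\<lambda>(A', B'). quality K L E A' B'"
  have P: "finite ?P" "?P \<noteq> {}" using fin by auto
  then have "Max (?q ` ?P) \<in> ?q ` ?P" by (intro Max_in) auto
  then obtain z where "z \<in> ?P" "?q z = Max (?q ` ?P)" by auto
  then have z: "z \<in> ?P" "\<And>y. y \<in> ?P \<Longrightarrow> ?q y \<le> ?q z"
    using P by simp_all
  obtain A1 B1 where z_eq: "z = (A1, B1)" by (cases z)
  have sub: "A1 \<subseteq> A" "B1 \<subseteq> B" using z z_eq by auto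
  have max: "quality K L E A' B' \<le> quality K L E A1 B1" if "A' \<subseteq> A" "B' \<subseteq> B" for A' B'
    using z(2) [of "(A', B')"] that z_eq by auto
  have "0 < card (E \<inter> A \<times> B)" "0 < card A" "0 < card B"
    using False fin by (auto simp: card_gt_0_iff)
  then have e: "0 < real (card (E \<inter> A \<times> B)) powr K * (real (card A) * real (card B)) powr (1 - K)"
    by simp
  then have le: "real (card (E \<inter> A \<times> B)) powr K * (real (card A) * real (card B)) powr (1 - K)
      \<le> quality K L E A B"
    unfolding quality_def using weight_ge_1 mult_left_mono [of 1] by fastforce
  \<comment> \<open>Positive quality forces an edge in the maximal pair, so both of its families are
    nonempty.\<close>
  with e max [of A B] have "0 < quality K L E A1 B1" by simp
  then have ne: "E \<inter> A1 \<times> B1 \<noteq> {}" by (auto simp: quality_def)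
  interpret opt: optimal_pair L A1 B1 K E
  proof
    show "finite A1" "finite B1" using sub fin finite_subset by blast+
    show "quality K L E A' B' \<le> quality K L E A1 B1" if "A' \<subseteq> A1" "B' \<subseteq> B1" for A' B'
      using that sub by (intro max) auto
  qed (use sub finL finite_elem prime_elem ne K in blast)+
  have "opt.\<theta> = \<theta>" by (simp add: opt.\<theta>_def \<theta>)
  have "quality K L E A1 B1 \<le> 16 * 1000 ^ card L * Q"
  proof (rule opt.quality_le)
    have "(\<Sum>p\<in>\<Union>(A1 \<union> B1) - L. two_point_const \<theta> * real p powr (- 2 * \<theta>))
        \<le> (\<Sum>p\<in>\<Union>(A \<union> B) - L. two_point_const \<theta> * real p powr (- 2 * \<theta>))"
      using sub finite_Union by (intro sum_mono2) (auto simp: two_point_const_def)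
    with tail show "(\<Sum>p\<in>\<Union>(A1 \<union> B1) - L. two_point_const opt.\<theta> * real p powr (- 2 * opt.\<theta>)) \<le> 1 / 2"
      by (simp add: \<open>opt.\<theta> = \<theta>\<close>)
  qed (rule Q)
  with le max [of A B] show ?thesis by simp
qed

subsection \<open>Square-free numbers\<close>

lemma squarefree_eq_prod_prime_factors:
  fixes n :: nat
  assumes "0 < n" "squarefree n"
  shows "n = \<Prod>(prime_factors n)"
proof -
  have "n = (\<Prod>p\<in>prime_factors n. p ^ multiplicity p n)"
    using assms by (simp add: prime_factorization_nat)
  also have "\<dots> = \<Prod>(prime_factors n)"
  proof (intro prod.cong refl)
    fix p assume "p \<in> prime_factors n"
    then have "multiplicity p n = 1"
      using assms squarefree_factorial_semiring' [of n] by simp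
    then show "p ^ multiplicity p n = p" by simp
  qed
  finally show ?thesis .
qed

text \<open>The gcd is the product of the common primes and cancels once from each of a and b. This
  turns the edge condition into one on symmetric differences.\<close>

lemma squarefree_ratio:
  fixes a b :: nat
  assumes a: "0 < a" "squarefree a" and b: "0 < b" "squarefree b"
  shows "real (a * b) / real ((gcd a b)\<^sup>2)
    = real (\<Prod>((prime_factors a - prime_factors b) \<union> (prime_factors b - prime_factors a)))"
proof -
  let ?a = "prime_factors a" and ?b = "prime_factors b"
  have "0 < gcd a b" "squarefree (gcd a b)"
    using a by (auto intro: squarefree_mono [of _ a])
  then have g: "gcd a b = \<Prod>(?a \<inter> ?b)"
    using squarefree_eq_prod_prime_factors [of "gcd a b"] a b by (simp add: prime_factors_gcd)
  have "a = \<Prod>?a" using a by (rule squarefree_eq_prod_prime_factors)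
  also have "\<dots> = \<Prod>(?a - ?b) * \<Prod>(?a \<inter> ?b)"
    by (subst prod.union_disjoint [symmetric]) (auto intro: prod.cong)
  finally have a_eq: "a = \<Prod>(?a - ?b) * gcd a b" by (simp only: g)
  have "b = \<Prod>?b" using b by (rule squarefree_eq_prod_prime_factors)
  also have "\<dots> = \<Prod>(?b - ?a) * \<Prod>(?a \<inter> ?b)"
    by (subst prod.union_disjoint [symmetric]) (auto intro: prod.cong)
  finally have b_eq: "b = \<Prod>(?b - ?a) * gcd a b" by (simp only: g)
  have "\<Prod>((?a - ?b) \<union> (?b - ?a)) = \<Prod>(?a - ?b) * \<Prod>(?b - ?a)"
    by (intro prod.union_disjoint) auto
  then have "a * b = \<Prod>((?a - ?b) \<union> (?b - ?a)) * (gcd a b)\<^sup>2"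
    by (subst (1) a_eq, subst (1) b_eq) (simp only: power2_eq_square mult_ac)
  then have "real (a * b) = real (\<Prod>((?a - ?b) \<union> (?b - ?a))) * real ((gcd a b)\<^sup>2)"
    by (metis of_nat_mult)
  then show ?thesis using \<open>0 < gcd a b\<close> by simp
qed

section \<open>Choice of the threshold and the final estimate\<close>

lemma tail_sum_powr:
  fixes C r :: real
  assumes "0 \<le> C" "r < - 1"
  shows "\<exists>P. \<forall>X. finite X \<longrightarrow> (\<forall>n\<in>X. P < real n) \<longrightarrow> (\<Sum>n\<in>X. C * real n powr r) \<le> 1 / 2"
proof -
  have "summable (\<lambda>n. C * real n powr r)"
    using assms by (intro summable_mult) (simp add: summable_real_powr_iff)
  \<comment> \<open>The Cauchy criterion gives a threshold uniform over all finite sets beyond it.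
    It depends only on C and r, so that \<open>P0\<close> will depend only on \<epsilon>.\<close>
  then obtain N where N: "\<And>m n. N \<le> m \<Longrightarrow> norm (\<Sum>n\<in>{m..<n}. C * real n powr r) < 1 / 2"
    unfolding summable_Cauchy by (metis half_gt_zero_iff zero_less_one)
  show ?thesis
  proof (intro exI [of _ "real N"] allI impI)
    fix X :: "nat set" assume X: "finite X" "\<forall>n\<in>X. real N < real n"
    have "(\<Sum>n\<in>X. C * real n powr r) \<le> (\<Sum>n\<in>{N..<Suc (Max X)}. C * real n powr r)"
      using X assms by (intro sum_mono2) (auto simp: less_Suc_eq_le)
    also have "\<dots> \<le> norm (\<Sum>n\<in>{N..<Suc (Max X)}. C * real n powr r)" by simp
    also have "\<dots> < 1 / 2" by (rule N) simp
    finally show "(\<Sum>n\<in>X. C * real n powr r) \<le> 1 / 2" by simp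
  qed
qed

theorem theorem5p1:
  fixes \<epsilon> :: real
  assumes "0 < \<epsilon>" and "\<epsilon> < 1"
  shows "\<exists>P0::real. \<forall>p0\<ge>P0. \<forall>(Q::real) (\<delta>::real) (A::nat set) (B::nat set).
           1 \<le> Q \<longrightarrow> 0 < \<delta> \<longrightarrow> \<delta> \<le> 1 \<longrightarrow>
           finite A \<longrightarrow> finite B \<longrightarrow>
           (\<forall>n\<in>A \<union> B. 0 < n \<and> squarefree n) \<longrightarrow>
           real (card {(a, b). a \<in> A \<and> b \<in> B \<and> real (a * b) / real ((gcd a b)\<^sup>2) \<le> Q})
             \<ge> \<delta> * real (card A) * real (card B) \<longrightarrow>
           real (card A) * real (card B)
             \<le> 1000 ^ (1 + card (primes_sml p0 (A \<union> B))) * \<delta> powr (- 2 - \<epsilon>) * (Q / 4)"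
proof -
  define K where "K = 2 + \<epsilon>"
  define \<theta> where "\<theta> = 1 - 1 / K"
  have K: "2 < K" "K \<le> 3" using assms by (auto simp: K_def)
  then have "- 2 * \<theta> < - 1" by (simp add: \<theta>_def field_simps)
  moreover have "0 \<le> two_point_const \<theta>" by (simp add: two_point_const_def)
  ultimately obtain P0 where P0: "\<And>X. finite X \<Longrightarrow> (\<And>n. n \<in> X \<Longrightarrow> P0 < real n) \<Longrightarrow>
      (\<Sum>n\<in>X. two_point_const \<theta> * real n powr (- 2 * \<theta>)) \<le> 1 / 2"
    using tail_sum_powr by meson
  show ?thesis
  proof (intro exI [of _ P0] allI impI)
    fix p0 Q \<delta> :: real and A B :: "nat set"
    assume p0: "P0 \<le> p0" and Q: "1 \<le> Q" and \<delta>: "0 < \<delta>" "\<delta> \<le> 1" and fin: "finite A" "finite B"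
      and sqf: "\<forall>n\<in>A \<union> B. 0 < n \<and> squarefree n"
      and edges: "\<delta> * real (card A) * real (card B)
        \<le> real (card {(a, b). a \<in> A \<and> b \<in> B \<and> real (a * b) / real ((gcd a b)\<^sup>2) \<le> Q})"
    define L where "L = primes_sml p0 (A \<union> B)"
    define G where "G = {(a, b). a \<in> A \<and> b \<in> B \<and> real (a * b) / real ((gcd a b)\<^sup>2) \<le> Q}"
    define m where "m = real (card A) * real (card B)"
    show "real (card A) * real (card B)
      \<le> 1000 ^ (1 + card (primes_sml p0 (A \<union> B))) * \<delta> powr (- 2 - \<epsilon>) * (Q / 4)"
    proof (cases "A = {} \<or> B = {}")
      case True
      then show ?thesis using Q by auto
    next
      case False
      then have m: "0 < m" using fin by (simp add: m_def card_gt_0_iff)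
      let ?A = "prime_factors ` A" and ?B = "prime_factors ` B"
      have inj: "inj_on prime_factors (A \<union> B)"
        using sqf squarefree_eq_prod_prime_factors by (intro inj_onI) metis
      have L_eq: "L = {p \<in> \<Union>(?A \<union> ?B). real p \<le> p0}"
        using sqf by (auto simp: L_def primes_sml_def in_prime_factors_iff)
      have finU: "finite (\<Union>(?A \<union> ?B))" using fin by auto
      \<comment> \<open>The encoding by prime factors is injective on square-free numbers, so it
        preserves the numbers of vertices and of edges.\<close>
      define E where "E = (\<lambda>(a, b). (prime_factors a, prime_factors b)) ` G"
      have GE: "card (E \<inter> ?A \<times> ?B) = card G"
      proof -
        have "E \<inter> ?A \<times> ?B = E" by (auto simp: E_def G_def)
        moreover have "inj_on (\<lambda>(a, b). (prime_factors a, prime_factors b)) G"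
          using inj by (auto simp: inj_on_def G_def)
        ultimately show ?thesis by (simp add: E_def card_image)
      qed
      have cards: "card ?A = card A" "card ?B = card B"
        using inj by (auto intro!: card_image intro: inj_on_subset)
      have "real (card (E \<inter> ?A \<times> ?B)) powr K * (real (card ?A) * real (card ?B)) powr (1 - K)
          \<le> 16 * 1000 ^ card L * Q"
      proof (rule card_edges_powr_le [OF _ K \<theta>_def])
        show "prime_set_families L ?A ?B"
        proof
          show "finite L" unfolding L_eq by (rule finite_subset [OF _ finU]) auto
        qed (use fin False in auto)
        \<comment> \<open>The primes outside \<open>L\<close> that occur exceed \<open>p0\<close>,
          hence \<open>P0\<close>.\<close>
        show "(\<Sum>p\<in>\<Union>(?A \<union> ?B) - L. two_point_const \<theta> * real p powr (- 2 * \<theta>)) \<le> 1 / 2"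
          using finU p0 by (intro P0) (auto simp: L_eq)
        fix a b assume "(a, b) \<in> E"
        then obtain x y where xy: "(x, y) \<in> G" "a = prime_factors x" "b = prime_factors y"
          by (auto simp: E_def)
        then have "0 < x" "squarefree x" "0 < y" "squarefree y" using sqf by (auto simp: G_def)
        from squarefree_ratio [OF this] xy
        show "real (\<Prod>((a - b) \<union> (b - a))) \<le> Q" by (simp add: G_def)
      qed (use Q in simp)
      then have le: "real (card G) powr K * m powr (1 - K) \<le> 16 * 1000 ^ card L * Q"
        by (simp add: GE cards m_def)
      \<comment> \<open>With at least \<open>\<delta> * m\<close> edges, the unweighted quality is
        at least \<open>\<delta> powr K * m\<close>; the choice \<open>K = 2 + \<epsilon>\<close>
        produces the required power of \<delta>.\<close>
      have "\<delta> powr K * m = (\<delta> * m) powr K * m powr (1 - K)"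
        using m \<delta> by (simp add: powr_mult powr_diff)
      also have "\<dots> \<le> real (card G) powr K * m powr (1 - K)"
        using edges K \<delta> m
        by (intro mult_right_mono powr_mono2) (auto simp: G_def m_def mult.assoc)
      also note le
      finally have "m \<le> 16 * 1000 ^ card L * Q * \<delta> powr - K"
        using \<delta> by (simp add: powr_minus field_simps)
      \<comment> \<open>The target constant is 1000 / 4 = 250, which leaves room for 16.\<close>
      also have "\<dots> \<le> 250 * 1000 ^ card L * Q * \<delta> powr - K"
        using Q by (intro mult_right_mono) auto
      also have "- K = - 2 - \<epsilon>" by (simp add: K_def)
      finally show ?thesis by (simp add: m_def L_def mult_ac)
    qed
  qed
qed

end
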